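(* Let $f=(f_1,f_2)$ be a pair of polynomials in $\mathbb{C}[x,y]$ such that the affine curves $(f_1)=\{f_1=0\}$ and $(f_2)=\{f_2=0\}$ intersect only at discrete points of $\mathbb{C}^2$. Suppose that: (RC1) for some positive integer $n$, $f_1$ and $f_2$ both have total degree $n$ and the leading (degree $n$) homogeneous part of each is $x^n$; (RC2) all intersection points of $(f_1)$ and $(f_2)$ in $\mathbb{C}^2$ lie on the line $\{y=0\}$. Let $v_i=(\alpha_i,0)$, $i=0,1,\dots,N$, be the distinct intersection points of $(f_1)$ and $(f_2)$ in $\mathbb{C}^2$, with $\alpha_0=0$, and set $r(x)=\prod_{i=0}^N(x-\alpha_i)$. Let $(g_1,g_2)$ be the unique pair of polynomials in $\mathbb{C}[x,y]$ with $\deg g_i\le n-1$ $(i=1,2)$ and $\mathcal{J}(f)\,y=g_1f_1+g_2f_2$. Suppose $\mathcal{J}(f)(v_i)\neq0$ for all $i=0,1,\dots,N$. Then $$g_1(x,0)=-r'(x)\,\frac{f_2(x,0)}{r(x)},\qquad g_2(x,0)=r'(x)\,\frac{f_1(x,0)}{r(x)},$$ where $r'(x)=\frac{dr}{dx}(x)$.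
   Context: $\mathcal{J}(f)=\frac{\partial(f_1,f_2)}{\partial(x,y)}=\frac{\partial f_1}{\partial x}\frac{\partial f_2}{\partial y}-\frac{\partial f_1}{\partial y}\frac{\partial f_2}{\partial x}$ denotes the Jacobian determinant. $\deg$ denotes total degree in $(x,y)$. (Under the stated hypotheses a pair $(g_1,g_2)$ with the stated degree bound exists and is unique.) Note that $r(x)$ divides $f_1(x,0)$ and $f_2(x,0)$. *)

theory Defs
  imports "HOL-Analysis.Analysis" "HOL-Computational_Algebra.Polynomial"
begin

text \<open>
  A polynomial in two variables \<open>x, y\<close> is an element of \<open>'a poly poly\<close>: the outer variable
  is \<open>y\<close> and the coefficients are polynomials in \<open>x\<close>. So the coefficient of \<open>x\<^sup>i y\<^sup>j\<close> in \<open>p\<close>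
  is \<open>coeff (coeff p j) i\<close>, and \<open>p(x,0)\<close>, as a polynomial in \<open>x\<close>, is \<open>poly p 0\<close>.
\<close>

definition varX :: "'a::comm_semiring_1 poly poly"
  where "varX = [:[:0, 1:]:]"

definition varY :: "'a::comm_semiring_1 poly poly"
  where "varY = [:0, 1:]"

definition eval2 :: "'a::comm_semiring_1 poly poly \<Rightarrow> 'a \<times> 'a \<Rightarrow> 'a"
  where "eval2 p v = poly (poly p [:snd v:]) (fst v)"

definition curve :: "'a::comm_semiring_1 poly poly \<Rightarrow> ('a \<times> 'a) set"
  where "curve p = {v. eval2 p v = 0}"

text \<open>The zero polynomial gets total degree \<open>0\<close>, as for \<^const>\<open>degree\<close>.\<close>

definition total_degree :: "'a::zero poly poly \<Rightarrow> nat"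
  where "total_degree p = Max (insert 0 {i + j | i j. coeff (coeff p j) i \<noteq> 0})"

definition hom_part :: "nat \<Rightarrow> 'a::comm_semiring_1 poly poly \<Rightarrow> 'a poly poly"
  where "hom_part d p = (\<Sum>j\<le>d. monom (monom (coeff (coeff p j) (d - j)) (d - j)) j)"

definition pdx :: "'a::{comm_semiring_1,semiring_no_zero_divisors} poly poly \<Rightarrow> 'a poly poly"
  where "pdx p = map_poly pderiv p"

definition pdy :: "'a::{comm_semiring_1,semiring_no_zero_divisors} poly poly \<Rightarrow> 'a poly poly"
  where "pdy p = pderiv p"

definition poly_jacobian :: "'a::idom poly poly \<Rightarrow> 'a poly poly \<Rightarrow> 'a poly poly"
  where "poly_jacobian p q = pdx p * pdy q - pdy p * pdx q"

lemma finite_exponent_sums: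
  fixes p :: "'a::zero poly poly"
  shows "finite {i + j | i j. coeff (coeff p j) i \<noteq> 0}"
proof -
  have "{i + j | i j. coeff (coeff p j) i \<noteq> 0}
      \<subseteq> (\<Union>j\<le>degree p. (\<lambda>i. i + j) ` {..degree (coeff p j)})"
  proof clarify
    fix i j assume nz: "coeff (coeff p j) i \<noteq> 0"
    hence "coeff p j \<noteq> 0" by auto
    hence "j \<le> degree p" by (rule le_degree)
    moreover have "i \<le> degree (coeff p j)" using nz by (rule le_degree)
    ultimately show "i + j \<in> (\<Union>j\<le>degree p. (\<lambda>i. i + j) ` {..degree (coeff p j)})" by auto
  qed
  thus ?thesis by (rule finite_subset) auto
qed

lemma total_degree_le_iff:
  "total_degree p \<le> d \<longleftrightarrow> (\<forall>i j. coeff (coeff p j) i \<noteq> 0 \<longrightarrow> i + j \<le> d)"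
  using finite_exponent_sums[of p] by (auto simp: total_degree_def)

lemma eval2_var [simp]: "eval2 varX (a, b) = a" "eval2 varY (a, b) = b"
  by (simp_all add: eval2_def varX_def varY_def)

lemma eval2_at_y0: "eval2 p (a, 0) = poly (poly p 0) a"
  by (simp add: eval2_def)

text \<open>
  By the next lemma \<open>r(x)\<close> divides \<open>f\<^sub>1(x,0)\<close> and \<open>f\<^sub>2(x,0)\<close>, so that \<open>f\<^sub>i(x,0) div r(x)\<close> is the
  exact quotient.
\<close>

lemma prod_linear_factors_dvd:
  fixes p :: "'a::field poly" and \<alpha> :: "'b \<Rightarrow> 'a"
  assumes "finite A" "inj_on \<alpha> A" "\<And>i. i \<in> A \<Longrightarrow> poly p (\<alpha> i) = 0"
  shows "(\<Prod>i\<in>A. [:- \<alpha> i, 1:]) dvd p"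
  using assms
proof (induction A arbitrary: p rule: finite_induct)
  case (insert a A)
  from insert.prems(2)[of a] obtain q where q: "p = [:- \<alpha> a, 1:] * q"
    by (auto simp: poly_eq_0_iff_dvd elim: dvdE)
  have "poly q (\<alpha> i) = 0" if "i \<in> A" for i
    using insert.prems(2)[of i] insert.prems(1) insert.hyps(2) that
    by (auto simp: q inj_on_def)
  hence "(\<Prod>i\<in>A. [:- \<alpha> i, 1:]) dvd q"
    using insert.IH[of q] insert.prems(1) by (auto simp: inj_on_def)
  hence "[:- \<alpha> a, 1:] * (\<Prod>i\<in>A. [:- \<alpha> i, 1:]) dvd [:- \<alpha> a, 1:] * q"
    by (rule mult_dvd_mono[OF dvd_refl])
  thus ?case by (simp only: q prod.insert[OF insert.hyps])
qed simp

end

theory Submission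
  imports
    Defs
    "HOL-Computational_Algebra.Field_as_Ring"
    "HOL-Computational_Algebra.Fundamental_Theorem_Algebra"
    "HOL-Computational_Algebra.Polynomial_Factorial"
begin

text \<open>
  On the line \<open>y = 0\<close> the relation reads \<open>g1 f1 + g2 f2 = 0\<close>. Put \<open>f1(x,0) = r a\<close> and
  \<open>f2(x,0) = r b\<close>. Since the Jacobian does not vanish at the intersection points, \<open>a\<close> and \<open>b\<close>
  are coprime, hence \<open>g1(x,0) = - h b\<close> and \<open>g2(x,0) = h a\<close> for some \<open>h\<close>, and the degree bound
  on \<open>g1\<close> gives \<open>deg h \<le> N\<close>. Differentiating the original relation at the intersection
  points yields \<open>h(\<alpha>\<^sub>i) = r'(\<alpha>\<^sub>i)\<close> for all \<open>N + 1\<close> values of \<open>i\<close>, so \<open>h = r'\<close>.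
\<close>

lemma poly_pdx_0: "poly (pdx p) 0 = pderiv (poly p 0)"
  by (simp add: pdx_def poly_0_coeff_0 coeff_map_poly)

text \<open>A common divisor of positive degree would have a root, and \<open>p\<close> and
  \<open>q\<close> would share it.\<close>

lemma coprime_poly_if_no_common_root:
  fixes p q :: "'a::alg_closed_field poly"
  assumes "\<And>t. poly p t = 0 \<Longrightarrow> poly q t \<noteq> 0"
  shows "coprime p q"
proof (rule coprimeI)
  fix c assume c: "c dvd p" "c dvd q"
  have no_root: "poly c t \<noteq> 0" for t
    using assms[of t] c by (auto elim!: dvdE)
  hence "degree c = 0"
    using alg_closed_imp_poly_has_root[of c] by blast
  moreover have "c \<noteq> 0"
    using no_root by auto
  ultimately show "is_unit c"
    by (simp add: is_unit_iff_degree)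
qed

lemma poly_pderiv_mult_at_root:
  fixes p q :: "'a::idom poly"
  assumes "poly p t = 0"
  shows "poly (pderiv (p * q)) t = poly (pderiv p) t * poly q t"
  using assms by (simp add: pderiv_mult)

lemma degree_poly_0_le_total_degree: "degree (poly p 0) \<le> total_degree p"
proof (cases "poly p 0 = 0")
  case False
  hence "coeff (coeff p 0) (degree (poly p 0)) \<noteq> 0"
    by (simp add: poly_0_coeff_0)
  thus ?thesis
    using total_degree_le_iff[of p "total_degree p"] by fastforce
qed simp

lemma coeff_hom_part_0: "coeff (coeff (hom_part d p) 0) d = coeff (coeff p 0) d"
  by (simp add: hom_part_def coeff_sum sum.delta)

lemma varX_power: "varX ^ n = [:monom 1 n:]"
  by (induction n) (simp_all add: varX_def monom_Suc one_pCons)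

text \<open>The monomial \<open>x^n\<close> does not involve \<open>y\<close>, so it survives the
  restriction to \<open>y = 0\<close>.\<close>

lemma degree_poly_0_ge_if_leading:
  assumes "hom_part n p = varX ^ n"
  shows "n \<le> degree (poly p 0)"
proof -
  have "coeff (poly p 0) n = 1"
    using coeff_hom_part_0[of n p] by (simp add: assms varX_power poly_0_coeff_0)
  thus ?thesis
    by (intro le_degree) simp
qed

text \<open>
  At a common zero the two partial derivatives of the relation form a linear system for
  \<open>(g1, g2)\<close> with determinant the Jacobian; Cramer's rule gives the values.
\<close>

lemma cofactors_at_transversal_zero:
  fixes f1 f2 g1 g2 :: "'a::idom poly poly"
  assumes eq: "poly_jacobian f1 f2 * varY = g1 * f1 + g2 * f2"
    and zero: "poly (poly f1 0) t = 0" "poly (poly f2 0) t = 0"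
    and nz: "eval2 (poly_jacobian f1 f2) (t, 0) \<noteq> 0"
  shows "poly (poly g1 0) t = - poly (pderiv (poly f2 0)) t"
    and "poly (poly g2 0) t = poly (pderiv (poly f1 0)) t"
proof -
  define u1 u2 where "u1 = poly (poly g1 0) t" and "u2 = poly (poly g2 0) t"
  define a b where "a = poly (pderiv (poly f1 0)) t" and "b = poly (pderiv (poly f2 0)) t"
  define c d where "c = poly (poly (pderiv f1) 0) t" and "d = poly (poly (pderiv f2) 0) t"
  have J: "eval2 (poly_jacobian f1 f2) (t, 0) = a * d - c * b"
    by (simp add: eval2_at_y0 poly_jacobian_def poly_pdx_0 pdy_def a_def b_def c_def d_def)
  have "poly (poly_jacobian f1 f2 * varY) 0 = poly (g1 * f1 + g2 * f2) 0"
    by (simp only: eq)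
  hence "poly (pderiv (poly g1 0 * poly f1 0 + poly g2 0 * poly f2 0)) t = 0"
    by (simp add: varY_def)
  hence x: "u1 * a + u2 * b = 0"
    by (simp add: pderiv_mult pderiv_add zero u1_def u2_def a_def b_def)
  \<comment> \<open>By the product rule, the \<open>y\<close>-derivative of the left side at
    \<open>y = 0\<close> is the Jacobian itself.\<close>
  have "poly (poly (pderiv (poly_jacobian f1 f2 * varY)) 0) t
      = poly (poly (pderiv (g1 * f1 + g2 * f2)) 0) t"
    by (simp only: eq)
  hence y: "a * d - c * b = u1 * c + u2 * d"
    using J by (simp add: pderiv_mult pderiv_add zero eval2_at_y0 varY_def pderiv_pCons
        u1_def u2_def c_def d_def)
  have "(a * d - c * b) * (u1 + b) = 0" "(a * d - c * b) * (u2 - a) = 0"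
    using x y by algebra+
  thus "poly (poly g1 0) t = - poly (pderiv (poly f2 0)) t"
    and "poly (poly g2 0) t = poly (pderiv (poly f1 0)) t"
    using nz unfolding J u1_def[symmetric] u2_def[symmetric] a_def[symmetric] b_def[symmetric]
    by (auto simp: eq_neg_iff_add_eq_0)
qed

theorem proposition5p4:
  fixes f1 f2 g1 g2 :: "complex poly poly"
    and n N :: nat
    and \<alpha> :: "nat \<Rightarrow> complex"
    and r :: "complex poly"
  assumes discrete: "discrete (curve f1 \<inter> curve f2)"
    and n_pos: "0 < n"
    and RC1_deg: "total_degree f1 = n" "total_degree f2 = n"
    and RC1_lead: "hom_part n f1 = varX ^ n" "hom_part n f2 = varX ^ n"
    and RC2: "\<forall>v \<in> curve f1 \<inter> curve f2. snd v = 0"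
    and points: "curve f1 \<inter> curve f2 = (\<lambda>i. (\<alpha> i, 0)) ` {0..N}"
    and distinct: "inj_on \<alpha> {0..N}"
    and alpha_0: "\<alpha> 0 = 0"
    and r: "r = (\<Prod>i=0..N. [:- \<alpha> i, 1:])"
    and g_deg: "total_degree g1 \<le> n - 1" "total_degree g2 \<le> n - 1"
    and g_eq: "poly_jacobian f1 f2 * varY = g1 * f1 + g2 * f2"
    and jac_nz: "\<forall>i\<in>{0..N}. eval2 (poly_jacobian f1 f2) (\<alpha> i, 0) \<noteq> 0"
  shows "poly g1 0 = - pderiv r * (poly f2 0 div r) \<and>
         poly g2 0 = pderiv r * (poly f1 0 div r)"
proof -
  define G1 G2 where "G1 = poly g1 0" and "G2 = poly g2 0"
  have common_root: "poly (poly f1 0) t = 0 \<and> poly (poly f2 0) t = 0 \<longleftrightarrow> t \<in> \<alpha> ` {0..N}" for t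
  proof -
    have "poly (poly f1 0) t = 0 \<and> poly (poly f2 0) t = 0 \<longleftrightarrow> (t, 0) \<in> curve f1 \<inter> curve f2"
      by (simp add: curve_def eval2_at_y0)
    thus ?thesis
      unfolding points by auto
  qed
  have r_root: "poly r (\<alpha> i) = 0" if "i \<in> {0..N}" for i
    using that by (auto simp: r poly_prod)
  have "r dvd poly f1 0" "r dvd poly f2 0"
    unfolding r using common_root distinct by (auto intro!: prod_linear_factors_dvd)
  then obtain a b where a: "poly f1 0 = r * a" and b: "poly f2 0 = r * b"
    by (elim dvdE)
  have deg_r: "degree r = Suc N"
    by (simp add: r degree_prod_sum_eq)
  hence "r \<noteq> 0" by auto
  have deg_b: "n \<le> degree (poly f2 0)"
    using RC1_lead(2) by (rule degree_poly_0_ge_if_leading)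
  hence "b \<noteq> 0"
    using n_pos b by auto

  \<comment> \<open>The factor \<open>r\<close> of \<open>f1(x,0)\<close> and \<open>f2(x,0)\<close>
    vanishes at \<open>\<alpha> i\<close>, so the derivatives there reduce to \<open>r' a\<close>
    and \<open>r' b\<close>.\<close>
  have G1_root: "poly G1 (\<alpha> i) = - (poly (pderiv r) (\<alpha> i) * poly b (\<alpha> i))"
    and G2_root: "poly G2 (\<alpha> i) = poly (pderiv r) (\<alpha> i) * poly a (\<alpha> i)"
    if "i \<in> {0..N}" for i
    using cofactors_at_transversal_zero[OF g_eq, of "\<alpha> i"] common_root[of "\<alpha> i"] jac_nz that
      r_root[OF that]
    by (simp_all add: G1_def G2_def a b poly_pderiv_mult_at_root)

  \<comment> \<open>A common zero of the quotients would be a common zero of \<open>f1\<close> and \<open>f2\<close> at which both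
      \<open>x\<close>-derivatives vanish, hence the Jacobian too.\<close>
  have no_common: "\<not> (poly a t = 0 \<and> poly b t = 0)" for t
  proof
    assume t: "poly a t = 0 \<and> poly b t = 0"
    then obtain i where i: "i \<in> {0..N}" "t = \<alpha> i"
      using common_root[of t] by (auto simp: a b)
    have "eval2 (poly_jacobian f1 f2) (t, 0) = 0"
      using t i r_root[of i]
      by (simp add: eval2_at_y0 poly_jacobian_def poly_pdx_0 a b poly_pderiv_mult_at_root)
    thus False
      using jac_nz i by blast
  qed
  hence "coprime b a"
    by (intro coprime_poly_if_no_common_root) auto

  have "poly (poly_jacobian f1 f2 * varY) 0 = poly (g1 * f1 + g2 * f2) 0"
    by (simp only: g_eq)
  hence "r * (G1 * a + G2 * b) = 0"
    by (simp add: varY_def a b G1_def G2_def algebra_simps)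
  hence rel: "G1 * a + G2 * b = 0"
    using \<open>r \<noteq> 0\<close> by simp
  hence "b dvd G1 * a"
    by (metis add.commute add_eq_0_iff dvd_minus_iff dvd_triv_right)
  hence "b dvd G1"
    using \<open>coprime b a\<close> by (simp add: coprime_dvd_mult_left_iff)
  then obtain k where "G1 = b * k" ..
  then obtain h where G1: "G1 = - h * b"
    by (metis minus_minus mult.commute)
  have "b * (G2 - h * a) = 0"
    using rel unfolding G1 by (simp add: algebra_simps)
  hence G2: "G2 = h * a"
    using \<open>b \<noteq> 0\<close> by simp

  \<comment> \<open>Compare \<open>deg h + deg b = deg G1 \<le> n - 1\<close> with
    \<open>n \<le> deg f2(x,0) = N + 1 + deg b\<close>; as \<open>n > 0\<close>, the truncated
    \<open>n - 1\<close> is strictly below \<open>n\<close>.\<close>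
  have "degree h < Suc N"
  proof (cases "h = 0")
    case False
    have "degree h + degree b = degree G1"
      using False \<open>b \<noteq> 0\<close> by (simp add: G1 degree_mult_eq)
    also have "\<dots> \<le> n - 1"
      unfolding G1_def using degree_poly_0_le_total_degree g_deg(1) by (rule order_trans)
    also have "\<dots> < degree (poly f2 0)"
      using deg_b n_pos by simp
    also have "\<dots> = Suc N + degree b"
      using \<open>r \<noteq> 0\<close> \<open>b \<noteq> 0\<close> by (simp add: b degree_mult_eq deg_r)
    finally show ?thesis by simp
  qed simp
  moreover have "degree (pderiv r) < Suc N"
    by (simp add: degree_pderiv deg_r)
  moreover have "poly h t = poly (pderiv r) t" if "t \<in> \<alpha> ` {0..N}" for t
    using that
  proof
    fix i assume "t = \<alpha> i" "i \<in> {0..N}"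
    \<comment> \<open>The values of \<open>G1\<close> and \<open>G2\<close> give
      \<open>h b = r' b\<close> and \<open>h a = r' a\<close> at \<open>t\<close>; one of
      \<open>a\<close>, \<open>b\<close> is nonzero there and cancels.\<close>
    thus ?thesis
      using G1_root[of i] G2_root[of i] no_common[of t] by (auto simp: G1 G2)
  qed
  \<comment> \<open>Two polynomials of degree at most \<open>N\<close> that agree at
    \<open>N + 1\<close> distinct points are equal.\<close>
  ultimately have "h = pderiv r"
    using distinct by (intro poly_eqI_degree[of "\<alpha> ` {0..N}"]) (auto simp: card_image)
  thus ?thesis
    using G1 G2 \<open>r \<noteq> 0\<close> by (simp add: a b G1_def G2_def)
qed

end
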